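(* Let $\mathbb{K}$ be a field, let $\varphi(z,x)=\sum_{m,n\ge 0}\varphi_{m,n}z^m x^n\in\mathbb{K}[[z,x]]$ be a bivariate formal power series, and let $(B_n)_{n\ge 1}$ be a sequence in $\mathbb{K}$ defining the hook weight $B$. Let $F(z)=F_{\varphi,B}(z)=\sum_{t}w_\varphi(t)B(t)z^{|t|}$, the sum over all decorated plane trees $t$ (defined in the context). Then: (1) for all $n\ge 1$, $[z^n]F(z)=B_n\,[z^{n-1}]\varphi(z,F(z))$; (2) $F(z)=L_B\bigl(\varphi(z,F(z))\bigr)$, where $L_B$ is the $\mathbb{K}$-linear operator on formal power series in $z$ with $L_B(z^n)=B_{n+1}z^{n+1}$ for all $n\ge 0$ (applied coefficientwise); (3) $F'(z)=L_B^*(1+\theta)\bigl(\varphi(z,F(z))\bigr)$, where $L_B^*(1+\theta)$ denotes the $\mathbb{K}$-linear operator on formal power series in $z$ (applied coefficientwise) sending $z^n$ to $(n+1)B_{n+1}z^n$ for all $n\ge 0$, and $\theta=z\frac{d}{dz}$.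
   Context: A decorated plane tree is a finite rooted plane (ordered) tree in which each vertex $v$ is assigned a positive integer size $|v|$; the size $|t|$ of a decorated tree (or forest) is the sum of the sizes of its vertices. For a vertex $v$ of a tree $t$, $t_v$ denotes the subtree of $t$ rooted at $v$ (consisting of $v$ and all its descendants), and $\deg(v)$ denotes the number of children of $v$. The hook weight associated to the sequence $(B_n)_{n\ge1}$ is $B(t)=\prod_{v\in V(t)}B_{|t_v|}$. The weight $w_\varphi(t)=\prod_{v\in V(t)}\varphi_{|v|-1,\deg(v)}$. $[z^n]G(z)$ denotes the coefficient of $z^n$ in the formal power series $G$. *)

theory Defs
  imports "HOL-Computational_Algebra.Formal_Power_Series"
begin

datatype dtree = Node (label: nat) (children: "dtree list")

(* The subtrees t_v for v ranging over the vertices of t, one entry per vertex (in preorder);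
   sums and products over V(t) are taken along this list. *)
primrec subtrees :: "dtree \<Rightarrow> dtree list" where
  "subtrees (Node k ts) = Node k ts # concat (map subtrees ts)"

definition decorated :: "dtree \<Rightarrow> bool" where
  "decorated t \<longleftrightarrow> (\<forall>s\<in>set (subtrees t). label s > 0)"

(* |t|; not to be confused with the size function generated by the datatype package. *)
definition tree_size :: "dtree \<Rightarrow> nat" where
  "tree_size t = (\<Sum>s\<leftarrow>subtrees t. label s)"

definition hook_weight :: "(nat \<Rightarrow> 'a::field) \<Rightarrow> dtree \<Rightarrow> 'a" where
  "hook_weight B t = (\<Prod>s\<leftarrow>subtrees t. B (tree_size s))"

(* K[[z,x]] is represented as K[[z]][[x]]: the outer index is the exponent of x,
   the inner one the exponent of z. *)
definition bicoeff :: "'a::field fps fps \<Rightarrow> nat \<Rightarrow> nat \<Rightarrow> 'a" where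
  "bicoeff \<phi> m n = fps_nth (fps_nth \<phi> n) m"

definition phi_weight :: "'a::field fps fps \<Rightarrow> dtree \<Rightarrow> 'a" where
  "phi_weight \<phi> t = (\<Prod>s\<leftarrow>subtrees t. bicoeff \<phi> (label s - 1) (length (children s)))"

(* Each coefficient is a finite sum, by finite_trees below. *)
definition hook_gf :: "'a::field fps fps \<Rightarrow> (nat \<Rightarrow> 'a) \<Rightarrow> 'a fps" where
  "hook_gf \<phi> B =
     Abs_fps (\<lambda>n. \<Sum>t | decorated t \<and> tree_size t = n. phi_weight \<phi> t * hook_weight B t)"

(* \<phi>(z,G(z)) for G with zero constant term: terms with i > n do not contribute to [z^n]
   (as in fps_compose); see sums_bi_subst below. *)
definition bi_subst :: "'a::field fps fps \<Rightarrow> 'a fps \<Rightarrow> 'a fps" where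
  "bi_subst \<phi> G = Abs_fps (\<lambda>n. \<Sum>i\<le>n. fps_nth (fps_nth \<phi> i * G ^ i) n)"

definition L_op :: "(nat \<Rightarrow> 'a::field) \<Rightarrow> 'a fps \<Rightarrow> 'a fps" where
  "L_op B f = Abs_fps (\<lambda>n. if n = 0 then 0 else B n * fps_nth f (n - 1))"

(* L_B^*(1 + \<theta>): the monomial z^n is an eigenvector of 1 + \<theta> with eigenvalue n + 1. *)
definition L_star_op :: "(nat \<Rightarrow> 'a::field) \<Rightarrow> 'a fps \<Rightarrow> 'a fps" where
  "L_star_op B f = Abs_fps (\<lambda>n. of_nat (n + 1) * B (n + 1) * fps_nth f n)"

lemma tree_size_Node: "tree_size (Node k ts) = k + (\<Sum>t\<leftarrow>ts. tree_size t)"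
  by (induction ts) (auto simp: tree_size_def)

lemma decorated_Node: "decorated (Node k ts) \<longleftrightarrow> k > 0 \<and> (\<forall>t\<in>set ts. decorated t)"
  by (auto simp: decorated_def)

lemma tree_size_pos: "decorated t \<Longrightarrow> tree_size t > 0"
  by (cases t) (auto simp: tree_size_Node decorated_Node)

lemma finite_trees_less: "finite {t. decorated t \<and> tree_size t < n}"
proof (induction n)
  case (Suc n)
  let ?A = "{t. decorated t \<and> tree_size t < n}"
  let ?L = "{ts. set ts \<subseteq> ?A \<and> length ts \<le> n}"
  have len: "length ts \<le> (\<Sum>t\<leftarrow>ts. tree_size t)" if "\<forall>t\<in>set ts. decorated t" for ts
    using that by (induction ts) (auto dest!: tree_size_pos)
  have sub: "{t. decorated t \<and> tree_size t < Suc n} \<subseteq> (\<lambda>(k, ts). Node k ts) ` ({..n} \<times> ?L)"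
  proof
    fix t assume "t \<in> {t. decorated t \<and> tree_size t < Suc n}"
    then obtain k ts where t: "t = Node k ts" and k: "k > 0" and ts: "\<forall>s\<in>set ts. decorated s"
      and le: "k + (\<Sum>s\<leftarrow>ts. tree_size s) \<le> n"
      by (cases t) (auto simp: tree_size_Node decorated_Node)
    have "tree_size s < n" if "s \<in> set ts" for s
      using member_le_sum_list[of "tree_size s" "map tree_size ts"] that k le by auto
    then show "t \<in> (\<lambda>(k, ts). Node k ts) ` ({..n} \<times> ?L)"
      using t ts le len[OF ts] by force
  qed
  have "finite ({..n} \<times> ?L)"
    using finite_lists_length_le[OF Suc] by simp
  then show ?case
    using sub finite_surj by blast
qed simp

lemma finite_trees: "finite {t. decorated t \<and> tree_size t = n}"
  by (rule finite_subset[OF _ finite_trees_less[of "Suc n"]]) auto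

lemma hook_gf_nth_0: "fps_nth (hook_gf \<phi> B) 0 = 0"
proof -
  have "{t. decorated t \<and> tree_size t = 0} = {}"
    using tree_size_pos by fastforce
  then show ?thesis
    unfolding hook_gf_def by (simp only: fps_nth_Abs_fps sum.empty)
qed

lemma sums_bi_subst:
  assumes "fps_nth G 0 = 0"
  shows "(\<lambda>i. fps_nth \<phi> i * G ^ i) sums bi_subst \<phi> G"
  unfolding sums_def
proof (rule tendsto_fpsI)
  fix n
  have zero: "fps_nth (fps_nth \<phi> i * G ^ i) n = 0" if "i > n" for i
    unfolding fps_mult_nth
    by (rule sum.neutral) (use that assms startsby_zero_power_prefix[of G i] in auto)
  have "fps_nth (\<Sum>i<k. fps_nth \<phi> i * G ^ i) n = fps_nth (bi_subst \<phi> G) n" if "k > n" for k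
    unfolding bi_subst_def fps_sum_nth fps_nth_Abs_fps
    by (rule sum.mono_neutral_right) (use that zero in auto)
  then show "\<forall>\<^sub>F k in sequentially. fps_nth (\<Sum>i<k. fps_nth \<phi> i * G ^ i) n = fps_nth (bi_subst \<phi> G) n"
    by (auto simp: eventually_at_top_dense)
qed

lemma L_op_monomial: "L_op B (fps_X ^ n) = fps_const (B (n + 1)) * fps_X ^ (n + 1)"
  by (rule fps_ext) (auto simp: L_op_def fps_X_power_nth simp del: power_Suc)

lemma L_op_linear:
  "L_op B (f + g) = L_op B f + L_op B g"
  "L_op B (fps_const c * f) = fps_const c * L_op B f"
  by (auto simp: L_op_def fps_eq_iff algebra_simps)

lemma L_star_op_monomial:
  "L_star_op B (fps_X ^ n) = fps_const (of_nat (n + 1) * B (n + 1)) * fps_X ^ n"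
  by (rule fps_ext) (auto simp: L_star_op_def fps_X_power_nth)

lemma L_star_op_linear:
  "L_star_op B (f + g) = L_star_op B f + L_star_op B g"
  "L_star_op B (fps_const c * f) = fps_const c * L_star_op B f"
  by (auto simp: L_star_op_def fps_eq_iff algebra_simps)

end

theory Submission
  imports Defs
begin

text \<open>Deleting the root turns a decorated tree into the root label \<open>k\<close> and an ordered forest of
  \<open>i\<close> decorated trees. The root contributes \<open>B\<^bsub>|t|\<^esub>\<close> and \<open>\<phi>\<^bsub>k-1,i\<^esub>\<close> to the weight, the
  remaining weight is multiplicative over the forest, and forests of \<open>i\<close> trees are counted by
  \<open>F\<^sup>i\<close>. Since \<open>B\<^bsub>|t|\<^esub>\<close> depends on the total size only, it factors out of \<open>[z\<^sup>n]F\<close>.\<close>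

definition tree_weight :: "'a::field fps fps \<Rightarrow> (nat \<Rightarrow> 'a) \<Rightarrow> dtree \<Rightarrow> 'a" where
  "tree_weight \<phi> B t = phi_weight \<phi> t * hook_weight B t"

definition trees :: "nat \<Rightarrow> dtree set" where
  "trees n = {t. decorated t \<and> tree_size t = n}"

definition forests :: "nat \<Rightarrow> nat \<Rightarrow> dtree list set" where
  "forests i n = {ts. length ts = i \<and> (\<forall>t\<in>set ts. decorated t) \<and> (\<Sum>t\<leftarrow>ts. tree_size t) = n}"

lemma prod_list_concat: "prod_list (concat xss) = prod_list (map prod_list xss)"
  for xss :: "'a::comm_monoid_mult list list"
  by (induction xss) auto

lemma prod_list_map_mult:
  "(\<Prod>x\<leftarrow>xs. f x * g x) = (\<Prod>x\<leftarrow>xs. f x) * (\<Prod>x\<leftarrow>xs. g x :: 'a::comm_monoid_mult)"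
  by (induction xs) (auto simp: ac_simps)

text \<open>An arbitrary factor \<open>f\<close> lets this serve both \<open>phi_weight\<close> and
  \<open>hook_weight\<close>.\<close>

lemma prod_list_map_subtrees_Node:
  "(\<Prod>s\<leftarrow>subtrees (Node k ts). f s) = f (Node k ts) * (\<Prod>t\<leftarrow>ts. \<Prod>s\<leftarrow>subtrees t. f s)"
  for f :: "dtree \<Rightarrow> 'a::comm_monoid_mult"
  by (simp add: map_concat prod_list_concat o_def)

lemma tree_weight_Node:
  "tree_weight \<phi> B (Node k ts) =
     B (tree_size (Node k ts)) * (bicoeff \<phi> (k - 1) (length ts) * (\<Prod>t\<leftarrow>ts. tree_weight \<phi> B t))"
  unfolding tree_weight_def phi_weight_def hook_weight_def prod_list_map_subtrees_Node
    prod_list_map_mult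
  by (simp add: ac_simps)

lemma hook_gf_nth: "fps_nth (hook_gf \<phi> B) n = (\<Sum>t\<in>trees n. tree_weight \<phi> B t)"
  by (simp add: hook_gf_def trees_def tree_weight_def)

lemma finite_trees_of_size: "finite (trees n)"
  unfolding trees_def by (rule finite_trees)

lemma forests_0: "forests 0 n = (if n = 0 then {[]} else {})"
  by (auto simp: forests_def)

text \<open>Splits off the first tree. Its size \<open>j\<close> is kept as an explicit index so
  that a sum over the forests becomes a Cauchy product.\<close>

lemma forests_Suc:
  "forests (Suc i) n = (\<lambda>(j, t, ts). t # ts) ` (SIGMA j:{0..n}. trees j \<times> forests i (n - j))"
proof
  show "forests (Suc i) n \<subseteq> (\<lambda>(j, t, ts). t # ts) ` (SIGMA j:{0..n}. trees j \<times> forests i (n - j))"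
  proof
    fix us assume "us \<in> forests (Suc i) n"
    then obtain t ts where "us = t # ts" "(tree_size t, t, ts) \<in> (SIGMA j:{0..n}. trees j \<times> forests i (n - j))"
      by (cases us) (auto simp: forests_def trees_def)
    then show "us \<in> (\<lambda>(j, t, ts). t # ts) ` (SIGMA j:{0..n}. trees j \<times> forests i (n - j))"
      by force
  qed
qed (auto simp: forests_def trees_def)

lemma finite_forests: "finite (forests i n)"
  by (induction i arbitrary: n) (auto simp: forests_0 forests_Suc finite_trees_of_size)

lemma hook_gf_power_nth:
  "fps_nth (hook_gf \<phi> B ^ i) n = (\<Sum>ts\<in>forests i n. \<Prod>t\<leftarrow>ts. tree_weight \<phi> B t)"
proof (induction i arbitrary: n)
  case 0
  show ?case by (simp add: forests_0)
next
  case (Suc i)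
  let ?w = "tree_weight \<phi> B"
  let ?S = "SIGMA j:{0..n}. trees j \<times> forests i (n - j)"
  \<comment> \<open>The index \<open>j\<close> is recovered as \<open>tree_size t\<close>.\<close>
  have inj: "inj_on (\<lambda>(j, t, ts). t # ts) ?S"
    by (auto simp: inj_on_def trees_def)
  have "fps_nth (hook_gf \<phi> B ^ Suc i) n =
      (\<Sum>j=0..n. \<Sum>(t, ts)\<in>trees j \<times> forests i (n - j). ?w t * (\<Prod>t\<leftarrow>ts. ?w t))"
    by (simp add: fps_mult_nth hook_gf_nth Suc.IH sum_product sum.cartesian_product)
  also have "\<dots> = (\<Sum>(j, t, ts)\<in>?S. ?w t * (\<Prod>t\<leftarrow>ts. ?w t))"
    by (subst sum.Sigma) (auto simp: finite_trees_of_size finite_forests)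
  also have "\<dots> = (\<Sum>ts\<in>forests (Suc i) n. \<Prod>t\<leftarrow>ts. ?w t)"
    unfolding forests_Suc by (subst sum.reindex[OF inj]) (auto intro!: sum.cong)
  finally show ?case .
qed

text \<open>Each decorated tree has size at least 1. This is why cutting off at
  \<open>i \<le> n\<close> in \<open>bi_subst\<close> loses no forest.\<close>

lemma length_le_sum_tree_size:
  "\<forall>t\<in>set ts. decorated t \<Longrightarrow> length ts \<le> (\<Sum>t\<leftarrow>ts. tree_size t)"
  by (induction ts) (auto dest!: tree_size_pos)

text \<open>Here \<open>m\<close> is the root label minus 1, hence the exponent of z in the root's
  factor of \<open>phi_weight\<close>, and \<open>i\<close> is the degree of the root, the exponent
  of x. The forest below the root has the remaining size \<open>n - m\<close>.\<close>

lemma trees_Suc: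
  "trees (Suc n) =
     (\<lambda>(i, m, ts). Node (Suc m) ts) ` (SIGMA i:{..n}. SIGMA m:{0..n}. forests i (n - m))"
proof
  show "trees (Suc n) \<subseteq>
      (\<lambda>(i, m, ts). Node (Suc m) ts) ` (SIGMA i:{..n}. SIGMA m:{0..n}. forests i (n - m))"
  proof
    fix t assume t: "t \<in> trees (Suc n)"
    obtain k ts where "t = Node k ts" by (cases t)
    with t obtain m where m: "t = Node (Suc m) ts" and ts: "\<forall>s\<in>set ts. decorated s"
      and size: "m + (\<Sum>s\<leftarrow>ts. tree_size s) = n"
      by (cases k) (auto simp: trees_def tree_size_Node decorated_Node)
    have "(length ts, m, ts) \<in> (SIGMA i:{..n}. SIGMA m:{0..n}. forests i (n - m))"
      using ts size length_le_sum_tree_size[OF ts] by (auto simp: forests_def)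
    then show "t \<in>
        (\<lambda>(i, m, ts). Node (Suc m) ts) ` (SIGMA i:{..n}. SIGMA m:{0..n}. forests i (n - m))"
      by (rule image_eqI[rotated]) (simp add: m)
  qed
qed (auto simp: trees_def forests_def tree_size_Node decorated_Node)

lemma hook_gf_nth_Suc:
  "fps_nth (hook_gf \<phi> B) (Suc n) = B (Suc n) * fps_nth (bi_subst \<phi> (hook_gf \<phi> B)) n"
proof -
  let ?w = "tree_weight \<phi> B"
  let ?S = "SIGMA i:{..n}. SIGMA m:{0..n}. forests i (n - m)"
  \<comment> \<open>The index \<open>i\<close> is recovered as \<open>length ts\<close>.\<close>
  have inj: "inj_on (\<lambda>(i, m, ts). Node (Suc m) ts) ?S"
    by (auto simp: inj_on_def forests_def)
  have "fps_nth (hook_gf \<phi> B) (Suc n) = (\<Sum>(i, m, ts)\<in>?S. ?w (Node (Suc m) ts))"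
    unfolding hook_gf_nth trees_Suc
    by (subst sum.reindex[OF inj]) (simp add: o_def case_prod_unfold)
  \<comment> \<open>Every tree indexed by \<open>?S\<close> has size \<open>Suc n\<close>, so its
    root contributes the same hook factor.\<close>
  also have "\<dots> = (\<Sum>(i, m, ts)\<in>?S. B (Suc n) * (bicoeff \<phi> m i * (\<Prod>t\<leftarrow>ts. ?w t)))"
    by (rule sum.cong) (auto simp: tree_weight_Node forests_def tree_size_Node)
  also have "\<dots> = (\<Sum>i\<le>n. \<Sum>(m, ts)\<in>(SIGMA m:{0..n}. forests i (n - m)).
      B (Suc n) * (bicoeff \<phi> m i * (\<Prod>t\<leftarrow>ts. ?w t)))"
    by (subst sum.Sigma) (auto simp: finite_forests)
  also have "\<dots> = (\<Sum>i\<le>n. \<Sum>m=0..n. \<Sum>ts\<in>forests i (n - m).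
      B (Suc n) * (bicoeff \<phi> m i * (\<Prod>t\<leftarrow>ts. ?w t)))"
    by (subst sum.Sigma) (auto simp: finite_forests)
  \<comment> \<open>By \<open>hook_gf_power_nth\<close> the sum over forests is the coefficient of
    F^i at \<open>n - m\<close>; the sum over \<open>m\<close> is then the Cauchy product of
    \<open>fps_nth \<phi> i\<close> with F^i.\<close>
  also have "\<dots> = B (Suc n) * fps_nth (bi_subst \<phi> (hook_gf \<phi> B)) n"
    by (simp add: bi_subst_def fps_mult_nth hook_gf_power_nth bicoeff_def sum_distrib_left)
  finally show ?thesis .
qed

theorem theorem2:
  fixes \<phi> :: "'a::field fps fps" and B :: "nat \<Rightarrow> 'a"
  defines "F \<equiv> hook_gf \<phi> B"
  shows "(\<forall>n\<ge>1. fps_nth F n = B n * fps_nth (bi_subst \<phi> F) (n - 1))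
       \<and> F = L_op B (bi_subst \<phi> F)
       \<and> fps_deriv F = L_star_op B (bi_subst \<phi> F)"
proof (intro conjI allI impI)
  show coeff: "fps_nth F n = B n * fps_nth (bi_subst \<phi> F) (n - 1)" if "n \<ge> 1" for n
    using that hook_gf_nth_Suc[of \<phi> B "n - 1"] by (simp add: F_def)
  show "F = L_op B (bi_subst \<phi> F)"
    \<comment> \<open>\<open>coeff\<close> leaves out index 0, where both sides vanish because no
      decorated tree has size 0.\<close>
    using coeff hook_gf_nth_0[of \<phi> B] by (auto simp: fps_eq_iff L_op_def F_def)
  show "fps_deriv F = L_star_op B (bi_subst \<phi> F)"
    \<comment> \<open>The derivative has n-th coefficient (n+1) times that of F at n+1, so
      \<open>coeff\<close> is used at n+1.\<close>
    using coeff by (auto simp: fps_eq_iff L_star_op_def)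
qed

end
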